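(* Let $\mathcal{A}$ and $\mathcal{B}$ be two unital complex $\ast$-algebras with multiplicative identities $1_{\mathcal{A}}$ and $1_{\mathcal{B}}$, respectively, such that $\mathcal{A}$ is prime and has a nontrivial projection. Let $\eta,\nu$ be nonzero complex numbers satisfying $\eta\neq -1$ and $|\nu|\neq 1$. Then every bijective (not necessarily linear or additive) map $\Phi:\mathcal{A}\rightarrow\mathcal{B}$ preserving the Jordan triple $\ast$-product $a\diamondsuit_{\eta}b\diamondsuit_{\nu}c$, that is, satisfying $$\Phi\big((a\diamondsuit_{\eta}b)\diamondsuit_{\nu}c\big)=\big(\Phi(a)\diamondsuit_{\eta}\Phi(b)\big)\diamondsuit_{\nu}\Phi(c)\quad\text{for all } a,b,c\in\mathcal{A},$$ is additive. In addition, if (i) $\Phi(1_{\mathcal{A}})$ is a projection of $\mathcal{B}$ and (ii) $\Phi(\nu(\overline{\eta}+1)a)=\nu(\overline{\eta}+1)\Phi(a)$ for all $a\in\mathcal{A}$, then $\Phi$ is a $\ast$-ring isomorphism. In particular, if $\Phi(1_{\mathcal{A}})$ is a projection of $\mathcal{B}$ and $\eta$ and $\nu$ are such that $\nu(\overline{\eta}+1)$ is a rational number, then $\Phi$ is a $\ast$-ring isomorphism.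
   Context: A complex $\ast$-algebra is an associative algebra over $\mathbb{C}$ with an involution $\ast$, i.e. a conjugate-linear map $a\mapsto a^{*}$ with $(ab)^{*}=b^{*}a^{*}$ and $(a^{*})^{*}=a$. For a nonzero complex number $\eta$ and elements $a,b$ of a complex $\ast$-algebra, the Jordan $\eta$-$\ast$-product is $a\diamondsuit_{\eta}b=ab+\eta ba^{*}$, and $a\diamondsuit_{\eta}b\diamondsuit_{\nu}c$ means $(a\diamondsuit_{\eta}b)\diamondsuit_{\nu}c$. A projection is an element $p$ with $p=p^{*}=p^{2}$; it is nontrivial if it is different from $0$ and the identity. The algebra $\mathcal{A}$ is prime if, for $a,b\in\mathcal{A}$, $a\mathcal{A}b=\{0\}$ implies $a=0$ or $b=0$. A $\ast$-ring isomorphism is a bijective map $\Phi$ that is additive, multiplicative ($\Phi(ab)=\Phi(a)\Phi(b)$) and satisfies $\Phi(a^{*})=\Phi(a)^{*}$ for all elements $a,b$ (no complex-linearity is required). *)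

theory Defs
  imports Complex_Main
begin

text \<open>
  Built on \<^class>\<open>ring\<close> and \<^class>\<open>monoid_mult\<close> rather than \<^class>\<open>ring_1\<close>, because the
  latter demands \<open>0 \<noteq> 1\<close>, which is not part of being a unital algebra.
\<close>

class complex_star_algebra_1 = ring + monoid_mult +
  fixes scaleC :: "complex \<Rightarrow> 'a \<Rightarrow> 'a" (infixr "*\<^sub>C" 75)
    and star :: "'a \<Rightarrow> 'a"
  assumes scaleC_add_right: "c *\<^sub>C (x + y) = c *\<^sub>C x + c *\<^sub>C y"
    and scaleC_add_left: "(c + d) *\<^sub>C x = c *\<^sub>C x + d *\<^sub>C x"
    and scaleC_scaleC: "c *\<^sub>C d *\<^sub>C x = (c * d) *\<^sub>C x"
    and scaleC_one: "1 *\<^sub>C x = x"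
    and mult_scaleC_left: "(c *\<^sub>C x) * y = c *\<^sub>C (x * y)"
    and mult_scaleC_right: "x * (c *\<^sub>C y) = c *\<^sub>C (x * y)"
    and star_add: "star (x + y) = star x + star y"
    and star_scaleC: "star (c *\<^sub>C x) = cnj c *\<^sub>C star x"
    and star_mult: "star (x * y) = star y * star x"
    and star_star: "star (star x) = x"

definition jordan_star_prod :: "complex \<Rightarrow> 'a::complex_star_algebra_1 \<Rightarrow> 'a \<Rightarrow> 'a"
  where "jordan_star_prod \<eta> a b = a * b + \<eta> *\<^sub>C (b * star a)"

definition projection :: "'a::complex_star_algebra_1 \<Rightarrow> bool"
  where "projection p \<longleftrightarrow> p = star p \<and> p = p\<^sup>2"

definition nontrivial_projection :: "'a::complex_star_algebra_1 \<Rightarrow> bool"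
  where "nontrivial_projection p \<longleftrightarrow> projection p \<and> p \<noteq> 0 \<and> p \<noteq> 1"

definition prime_algebra :: "'a::complex_star_algebra_1 itself \<Rightarrow> bool"
  where "prime_algebra _ \<longleftrightarrow> (\<forall>a b :: 'a. (\<forall>x. a * x * b = 0) \<longrightarrow> a = 0 \<or> b = 0)"

definition star_ring_iso :: "('a::complex_star_algebra_1 \<Rightarrow> 'b::complex_star_algebra_1) \<Rightarrow> bool"
  where "star_ring_iso f \<longleftrightarrow> bij f \<and> additive f \<and>
    (\<forall>a b. f (a * b) = f a * f b) \<and> (\<forall>a. f (star a) = star (f a))"

end

theory Submission
  imports Defs
begin

text \<open>
  Since \<open>\<eta> \<noteq> -1\<close>, putting \<open>1\<close> into the first slot of the triple product shows that \<open>\<Phi>\<close> turns the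
  binary product \<open>x \<circ> y = x y + \<nu> y x\<^sup>*\<close> into an expression that is biadditive in the images. Hence a
  relation \<open>\<Phi> h = \<Sum> \<Phi> a\<^sub>i\<close> is inherited by \<open>x \<circ> h\<close> and by \<open>h \<circ> y\<close>. For a projection \<open>p\<close> and
  \<open>x = \<alpha> p + \<beta> (1 - p)\<close>, the map \<open>h \<mapsto> x \<circ> h\<close> multiplies the four Peirce components of \<open>h\<close> by
  scalars, and as \<open>|\<nu>| \<noteq> 1\<close> one can choose \<open>\<alpha>, \<beta>\<close> to kill exactly one prescribed component.
  Three such maps isolate any component, so \<open>\<Phi>\<close> is additive across the Peirce decomposition.
  Expanding \<open>(p + a) \<circ> (1 - p + b)\<close> gives additivity on the off-diagonal components, and primeness
  carries it over to the diagonal ones.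

  If \<open>\<Phi> 1\<close> is a projection, the preimage \<open>b\<close> of \<open>1 - \<Phi> 1\<close> has \<open>(1 \<diamondsuit> b) \<diamondsuit> 1 = 0\<close>, whence
  \<open>\<Phi> 1 = 1\<close>. The triples \<open>(1, 1, c)\<close> and \<open>(1, c, 1)\<close> then show that \<open>\<Phi>\<close> commutes with
  \<open>1 + \<eta>\<close> and with the involution, and \<open>(1, b, c)\<close> shows that the defect
  \<open>D b c = \<Phi> (b c) - \<Phi> b \<Phi> c\<close> satisfies \<open>(1 + \<eta>) D b c = - \<nu> (1 + cnj \<eta>) D c b\<^sup>*\<close>. Four
  iterations of this identity return to \<open>D b c\<close> with a factor of modulus \<open>|\<nu>|\<^sup>4 \<noteq> 1\<close>.
\<close>

section \<open>Complex star-algebras\<close>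

global_interpretation scaleC: vector_space "scaleC :: complex \<Rightarrow> 'a \<Rightarrow> 'a::complex_star_algebra_1"
  by unfold_locales (simp_all add: scaleC_add_right scaleC_add_left scaleC_scaleC scaleC_one)

lemmas scaleC_simps = scaleC_add_right scaleC_add_left scaleC_scaleC
  mult_scaleC_left mult_scaleC_right

global_interpretation star: additive "star :: 'a \<Rightarrow> 'a::complex_star_algebra_1"
  by unfold_locales (rule star_add)

lemma star_one [simp]: "star (1 :: 'a::complex_star_algebra_1) = 1"
  using star_mult[of "star (1 :: 'a)" 1] by (simp add: star_star)

lemmas star_simps = star_add star.zero star.diff star_scaleC star_mult star_star

lemma mult_cnj_neq_one:
  assumes "cmod \<nu> \<noteq> 1"
  shows "\<nu> * cnj \<nu> \<noteq> 1"
proof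
  assume "\<nu> * cnj \<nu> = 1"
  hence "cmod \<nu> * cmod \<nu> = 1" by (metis complex_mod_cnj norm_mult norm_one)
  thus False using assms norm_ge_zero[of \<nu>] by (simp add: square_eq_1_iff)
qed

text \<open>Substituting the adjoint of the equation into itself gives
  \<open>d = (\<nu> * cnj \<nu>) *\<^sub>C d\<close>, and that factor is not 1.\<close>

lemma scaleC_real_linear_eq_zero:
  fixes d :: "'a::complex_star_algebra_1"
  assumes "cmod \<nu> \<noteq> 1" and "d + \<nu> *\<^sub>C star d = 0"
  shows "d = 0"
proof -
  have d: "d = - (\<nu> *\<^sub>C star d)"
    using assms(2) by (simp add: eq_neg_iff_add_eq_0)
  have "star d = - (cnj \<nu> *\<^sub>C d)"
    by (subst d) (simp add: star.minus star_simps)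
  with d have "d = (\<nu> * cnj \<nu>) *\<^sub>C d"
    by (simp add: scaleC_scaleC)
  hence "(1 - \<nu> * cnj \<nu>) *\<^sub>C d = 0"
    by (simp add: scaleC.scale_left_diff_distrib scaleC_one)
  moreover have "1 - \<nu> * cnj \<nu> \<noteq> 0"
    using mult_cnj_neq_one[OF assms(1)] by simp
  ultimately show ?thesis by simp
qed

lemma scalar_real_linear_surj:
  fixes \<nu> \<mu> :: complex
  assumes "cmod \<nu> \<noteq> 1"
  obtains \<xi> where "\<xi> + \<nu> * cnj \<xi> = \<mu>"
proof -
  have "1 - \<nu> * cnj \<nu> \<noteq> 0"
    using mult_cnj_neq_one[OF assms] by simp
  moreover from this have "1 - cnj \<nu> * \<nu> \<noteq> 0" by (simp add: mult.commute)
  \<comment> \<open>The witness arises by eliminating \<open>cnj \<xi>\<close> between the equation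
    and its conjugate.\<close>
  ultimately have "(\<mu> - \<nu> * cnj \<mu>) / (1 - \<nu> * cnj \<nu>)
      + \<nu> * cnj ((\<mu> - \<nu> * cnj \<mu>) / (1 - \<nu> * cnj \<nu>)) = \<mu>"
    by (simp add: divide_simps) (simp add: algebra_simps)
  thus ?thesis by (rule that)
qed

section \<open>Jordan products and Peirce corners\<close>

lemma jordan_star_prod_add_left:
  "jordan_star_prod \<nu> (a + b) c = jordan_star_prod \<nu> a c + jordan_star_prod \<nu> b c"
  by (simp add: jordan_star_prod_def star_simps scaleC_simps algebra_simps)

lemma jordan_star_prod_add_right:
  "jordan_star_prod \<nu> a (b + c) = jordan_star_prod \<nu> a b + jordan_star_prod \<nu> a c"
  by (simp add: jordan_star_prod_def star_simps scaleC_simps algebra_simps)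

lemma jordan_star_prod_zero [simp]:
  "jordan_star_prod \<nu> 0 c = 0" "jordan_star_prod \<nu> a 0 = 0"
  by (simp_all add: jordan_star_prod_def star_simps)

lemma jordan_star_prod_one_left: "jordan_star_prod \<eta> 1 b = (1 + \<eta>) *\<^sub>C b"
  by (simp add: jordan_star_prod_def scaleC_simps)

lemma jordan_star_prod_scalar_left:
  "jordan_star_prod \<nu> (\<xi> *\<^sub>C 1) c = (\<xi> + \<nu> * cnj \<xi>) *\<^sub>C c"
  by (simp add: jordan_star_prod_def star_scaleC mult_scaleC_left mult_scaleC_right
      scaleC_add_left)

text \<open>For idempotents this is membership in the corner eAf; the equational form serves
  directly as rewrite rules.\<close>

definition peirce :: "'a::complex_star_algebra_1 \<Rightarrow> 'a \<Rightarrow> 'a \<Rightarrow> bool"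
  where "peirce e f a \<longleftrightarrow> e * a = a \<and> a * f = a"

lemma peirce_zero [simp]: "peirce e f 0"
  by (simp add: peirce_def)

lemma peirce_add: "peirce e f a \<Longrightarrow> peirce e f b \<Longrightarrow> peirce e f (a + b)"
  by (simp add: peirce_def algebra_simps)

lemma peirce_scaleC: "peirce e f a \<Longrightarrow> peirce e f (c *\<^sub>C a)"
  by (simp add: peirce_def scaleC_simps)

lemma projection_idem: "projection p \<Longrightarrow> p * p = p"
  unfolding projection_def power2_eq_square by (elim conjE) (rule sym)

lemma projection_star: "projection p \<Longrightarrow> star p = p"
  unfolding projection_def by (elim conjE) (rule sym)

lemma projection_compl:
  assumes "projection p"
  shows "projection (1 - p)"
  unfolding projection_def
  by (simp add: projection_idem[OF assms] projection_star[OF assms] star.diff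
      power2_eq_square algebra_simps)

lemma projection_idem_left: "projection p \<Longrightarrow> p * (p * a) = p * a"
  by (metis mult.assoc projection_idem)

lemma nontrivial_projection_compl: "nontrivial_projection p \<Longrightarrow> nontrivial_projection (1 - p)"
  by (simp add: nontrivial_projection_def projection_compl)

lemma peirce_compl_iff:
  "peirce e (1 - f) a \<longleftrightarrow> e * a = a \<and> a * f = 0"
  "peirce (1 - e) f a \<longleftrightarrow> e * a = 0 \<and> a * f = a"
  by (auto simp: peirce_def algebra_simps)

lemma peirce_decomposition:
  assumes "projection p"
  obtains a11 a12 a21 a22 where
    "peirce p p a11" "peirce p (1 - p) a12" "peirce (1 - p) p a21" "peirce (1 - p) (1 - p) a22"
    "a = a11 + a12 + a21 + a22"
proof
  note [simp] = projection_idem[OF assms] projection_idem_left[OF assms]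
  show "peirce p p (p * a * p)" "peirce p (1 - p) (p * a * (1 - p))"
    "peirce (1 - p) p ((1 - p) * a * p)" "peirce (1 - p) (1 - p) ((1 - p) * a * (1 - p))"
    by (simp_all add: peirce_def algebra_simps)
  show "a = p * a * p + p * a * (1 - p) + (1 - p) * a * p + (1 - p) * a * (1 - p)"
    by (simp add: algebra_simps)
qed

lemma peirce_components_eq:
  assumes p: "projection p"
    and "peirce p p a" "peirce p (1 - p) b" "peirce (1 - p) p c" "peirce (1 - p) (1 - p) d"
    and "peirce p p a'" "peirce p (1 - p) b'" "peirce (1 - p) p c'" "peirce (1 - p) (1 - p) d'"
    and eq: "a + b + c + d = a' + b' + c' + d'"
  shows "a = a'" "b = b'" "c = c'" "d = d'"
proof -
  note mem = assms(2-9)[unfolded peirce_compl_iff] assms(2,6)[unfolded peirce_def]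
  have l: "a + b = a' + b'"
    using arg_cong[OF eq, of "\<lambda>x. p * x"] mem by (simp add: distrib_left peirce_def algebra_simps)
  show a: "a = a'"
    using arg_cong[OF l, of "\<lambda>x. x * p"] mem by (simp add: distrib_right)
  show b: "b = b'" using l a by simp
  have l': "c + d = c' + d'" using eq l by (simp add: add.assoc a b)
  show c: "c = c'"
    using arg_cong[OF l', of "\<lambda>x. x * p"] mem by (simp add: algebra_simps peirce_def)
  show "d = d'" using l' c by simp
qed

text \<open>With x_1 = \<alpha> and x_2 = \<beta>, the (i,j) component picks up x_i from left
  multiplication and \<nu> \<open>cnj\<close> x_j from right multiplication by the adjoint.\<close>

lemma jordan_star_prod_peirce:
  assumes "projection p"
    and "peirce p p a" "peirce p (1 - p) b" "peirce (1 - p) p c" "peirce (1 - p) (1 - p) d"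
  shows "jordan_star_prod \<nu> (\<alpha> *\<^sub>C p + \<beta> *\<^sub>C (1 - p)) (a + b + c + d)
    = (\<alpha> + \<nu> * cnj \<alpha>) *\<^sub>C a + (\<alpha> + \<nu> * cnj \<beta>) *\<^sub>C b
      + (\<beta> + \<nu> * cnj \<alpha>) *\<^sub>C c + (\<beta> + \<nu> * cnj \<beta>) *\<^sub>C d"
proof -
  have "p * a = a" "a * p = a" "p * b = b" "b * p = 0" "p * c = 0" "c * p = c" "p * d = 0" "d * p = 0"
    using assms(2-5) by (simp_all add: peirce_def algebra_simps)
  thus ?thesis using projection_star[OF assms(1)]
    by (simp add: jordan_star_prod_def star_simps scaleC_simps algebra_simps
        scaleC.scale_right_diff_distrib)
qed

section \<open>Additivity\<close>

locale jordan_triple_map =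
  fixes \<Phi> :: "'a::complex_star_algebra_1 \<Rightarrow> 'b::complex_star_algebra_1"
    and \<eta> \<nu> :: complex
  assumes \<eta>: "\<eta> \<noteq> -1" and \<nu>: "\<nu> \<noteq> 0" "cmod \<nu> \<noteq> 1" and bij: "bij \<Phi>"
    and triple: "\<Phi> (jordan_star_prod \<nu> (jordan_star_prod \<eta> a b) c)
      = jordan_star_prod \<nu> (jordan_star_prod \<eta> (\<Phi> a) (\<Phi> b)) (\<Phi> c)"
begin

lemma one_plus_\<eta>: "1 + \<eta> \<noteq> 0"
  using \<eta> by (metis add_eq_0_iff add.inverse_inverse)

lemma eq_iff: "\<Phi> a = \<Phi> b \<longleftrightarrow> a = b"
  using bij_is_inj[OF bij] by (rule inj_eq)

lemma surjE: obtains a where "\<Phi> a = b"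
  using surjD[OF bij_is_surj[OF bij]] by metis

lemma zero [simp]: "\<Phi> 0 = 0"
proof -
  obtain a where a: "\<Phi> a = 0" by (rule surjE)
  from triple[of 0 0 a] show ?thesis by (simp add: a)
qed

text \<open>The factor \<open>inverse (1 + \<eta>)\<close> undoes
  \<open>jordan_star_prod \<eta> 1\<close>, so the first two slots of the triple product amount to b
  itself.\<close>

definition \<Psi> :: "'a \<Rightarrow> 'b"
  where "\<Psi> b = jordan_star_prod \<eta> (\<Phi> 1) (\<Phi> (inverse (1 + \<eta>) *\<^sub>C b))"

lemma prod: "\<Phi> (jordan_star_prod \<nu> b c) = jordan_star_prod \<nu> (\<Psi> b) (\<Phi> c)"
  using triple[of 1 "inverse (1 + \<eta>) *\<^sub>C b" c] one_plus_\<eta>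
  by (simp add: \<Psi>_def jordan_star_prod_one_left scaleC_simps)

text \<open>Four summands match the four Peirce components; shorter sums are padded with 0.\<close>

lemma prod_right:
  assumes "\<Phi> h = \<Phi> a + \<Phi> b + \<Phi> c + \<Phi> d"
  shows "\<Phi> (jordan_star_prod \<nu> x h) = \<Phi> (jordan_star_prod \<nu> x a) + \<Phi> (jordan_star_prod \<nu> x b)
    + \<Phi> (jordan_star_prod \<nu> x c) + \<Phi> (jordan_star_prod \<nu> x d)"
  by (simp add: prod assms jordan_star_prod_add_right)

text \<open>Each scalar acts as a left factor \<open>\<xi> *\<^sub>C 1\<close>. This is what lets
  \<Psi>, which rescales its argument, inherit the relation.\<close>

lemma scale:
  assumes "\<Phi> h = \<Phi> a + \<Phi> b + \<Phi> c + \<Phi> d"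
  shows "\<Phi> (\<mu> *\<^sub>C h) = \<Phi> (\<mu> *\<^sub>C a) + \<Phi> (\<mu> *\<^sub>C b) + \<Phi> (\<mu> *\<^sub>C c) + \<Phi> (\<mu> *\<^sub>C d)"
proof -
  obtain \<xi> where "\<xi> + \<nu> * cnj \<xi> = \<mu>" using \<nu>(2) by (rule scalar_real_linear_surj)
  with prod_right[OF assms, of "\<xi> *\<^sub>C 1"] show ?thesis
    by (simp add: jordan_star_prod_scalar_left)
qed

lemma \<Psi>_eq:
  assumes "\<Phi> h = \<Phi> a + \<Phi> b + \<Phi> c + \<Phi> d"
  shows "\<Psi> h = \<Psi> a + \<Psi> b + \<Psi> c + \<Psi> d"
  by (simp add: \<Psi>_def scale[OF assms] jordan_star_prod_add_right)

lemma peirce_weights: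
  assumes "projection p"
    and "peirce p p a" "peirce p (1 - p) b" "peirce (1 - p) p c" "peirce (1 - p) (1 - p) d"
    and "peirce p p a'" "peirce p (1 - p) b'" "peirce (1 - p) p c'" "peirce (1 - p) (1 - p) d'"
    and "\<Phi> (a + b + c + d) = \<Phi> a' + \<Phi> b' + \<Phi> c' + \<Phi> d'"
  shows "\<Phi> ((\<alpha> + \<nu> * cnj \<alpha>) *\<^sub>C a + (\<alpha> + \<nu> * cnj \<beta>) *\<^sub>C b
      + (\<beta> + \<nu> * cnj \<alpha>) *\<^sub>C c + (\<beta> + \<nu> * cnj \<beta>) *\<^sub>C d)
    = \<Phi> ((\<alpha> + \<nu> * cnj \<alpha>) *\<^sub>C a') + \<Phi> ((\<alpha> + \<nu> * cnj \<beta>) *\<^sub>C b')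
      + \<Phi> ((\<beta> + \<nu> * cnj \<alpha>) *\<^sub>C c') + \<Phi> ((\<beta> + \<nu> * cnj \<beta>) *\<^sub>C d')"
proof -
  note J = jordan_star_prod_peirce[OF assms(1), of _ _ _ _ \<nu> \<alpha> \<beta>]
  show ?thesis
    using prod_right[OF assms(10), of "\<alpha> *\<^sub>C p + \<beta> *\<^sub>C (1 - p)"] J[OF assms(2-5)]
      J[OF assms(6) peirce_zero peirce_zero peirce_zero]
      J[OF peirce_zero assms(7) peirce_zero peirce_zero]
      J[OF peirce_zero peirce_zero assms(8) peirce_zero]
      J[OF peirce_zero peirce_zero peirce_zero assms(9)]
    by simp
qed

text \<open>These multipliers remain on the surviving components in \<open>peirce_components\<close>
  and must be cancelled there; each could vanish only for |\<nu>| = 1.\<close>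

lemma weights_nonzero: "1 + \<nu> \<noteq> 0" "\<nu> - 1 / cnj \<nu> \<noteq> 0" "- 1 / cnj \<nu> - 1 \<noteq> 0"
proof -
  show 1: "1 + \<nu> \<noteq> 0"
    using \<nu>(2) by (metis add_eq_0_iff norm_minus_cancel norm_one)
  show "\<nu> - 1 / cnj \<nu> \<noteq> 0"
  proof
    assume "\<nu> - 1 / cnj \<nu> = 0"
    hence "\<nu> * cnj \<nu> = 1" using \<nu>(1) by (simp add: field_simps)
    thus False using mult_cnj_neq_one[OF \<nu>(2)] by simp
  qed
  show "- 1 / cnj \<nu> - 1 \<noteq> 0"
  proof
    assume "- 1 / cnj \<nu> - 1 = 0"
    hence "cnj \<nu> = - 1" using \<nu>(1) by (simp add: field_simps)
    hence "cnj (1 + \<nu>) = 0" by simp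
    thus False using 1 by (simp only: complex_cnj_zero_iff)
  qed
qed

lemma peirce_components:
  assumes p: "projection p"
    and h: "peirce p p a" "peirce p (1 - p) b" "peirce (1 - p) p c" "peirce (1 - p) (1 - p) d"
    and h': "peirce p p a'" "peirce p (1 - p) b'" "peirce (1 - p) p c'" "peirce (1 - p) (1 - p) d'"
    and eq: "\<Phi> (a + b + c + d) = \<Phi> a' + \<Phi> b' + \<Phi> c' + \<Phi> d'"
  shows "a = a'" "b = b'"
proof -
  note sc = peirce_scaleC
  \<comment> \<open>The weights on the components 11, 12, 21, 22 are 1 + \<nu>, 1, \<nu>, 0.\<close>
  note kill22 = peirce_weights[OF assms, where \<alpha> = 1 and \<beta> = 0, simplified]
  \<comment> \<open>Applied to the rescaled components; this choice makes
    \<open>\<beta> + \<nu> * cnj \<alpha>\<close> vanish, which removes component 21.\<close>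
  note kill22_21 = peirce_weights[OF p sc sc sc peirce_zero sc sc sc peirce_zero,
      OF h(1-3) h'(1-3), of "1 + \<nu>" 1 \<nu> "1 + \<nu>" 1 \<nu>,
      where \<alpha> = "- 1 / cnj \<nu>" and \<beta> = 1]
  have 1: "\<Phi> (((- 1 / cnj \<nu> - 1) * (1 + \<nu>)) *\<^sub>C a + (\<nu> - 1 / cnj \<nu>) *\<^sub>C b)
    = \<Phi> (((- 1 / cnj \<nu> - 1) * (1 + \<nu>)) *\<^sub>C a') + \<Phi> ((\<nu> - 1 / cnj \<nu>) *\<^sub>C b')"
    using kill22_21 kill22 \<nu>(1) by simp
  note rest = peirce_weights[OF p sc sc peirce_zero peirce_zero sc sc peirce_zero peirce_zero,
      OF h(1-2) h'(1-2), simplified, OF 1]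
  \<comment> \<open>The parameters 1, -1 / \<open>cnj \<nu>\<close> remove component 12, and 0, 1
    remove component 11; injectivity then compares what is left.\<close>
  show "a = a'"
    using rest[of 1 "- 1 / cnj \<nu>"] \<nu>(1) weights_nonzero
    by (simp add: scaleC_simps eq_iff)
  show "b = b'"
    using rest[of 0 1] \<nu>(1) weights_nonzero
    by (simp add: scaleC_simps eq_iff)
qed

lemma peirce_sum:
  assumes p: "projection p"
    and a: "peirce p p a" "peirce p (1 - p) b" "peirce (1 - p) p c" "peirce (1 - p) (1 - p) d"
  shows "\<Phi> (a + b + c + d) = \<Phi> a + \<Phi> b + \<Phi> c + \<Phi> d"
proof -
  obtain h where h: "\<Phi> h = \<Phi> a + \<Phi> b + \<Phi> c + \<Phi> d" by (rule surjE)
  obtain a' b' c' d' where h':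
    "peirce p p a'" "peirce p (1 - p) b'" "peirce (1 - p) p c'" "peirce (1 - p) (1 - p) d'"
    and sum: "h = a' + b' + c' + d'"
    using peirce_decomposition[OF p] by metis
  have "a' = a" "b' = b" using peirce_components[OF p h' a] h sum by auto
  \<comment> \<open>Exchanging p and 1 - p turns the last two components into the first two.\<close>
  moreover have "d' = d" "c' = c"
    using peirce_components[OF projection_compl[OF p], of d' c' b' a' d c b a] h h' a sum
    by (simp_all add: ac_simps)
  ultimately show ?thesis using h sum by simp
qed

lemma add_peirce12:
  assumes p: "projection p" and a: "peirce p (1 - p) a" and b: "peirce p (1 - p) b"
  shows "\<Phi> (a + b) = \<Phi> a + \<Phi> b"
proof -
  note pp = projection_idem[OF p]
  have a1: "p * a = a" "a * p = 0" and b1: "p * b = b" "b * p = 0"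
    using a b by (simp_all add: peirce_compl_iff)
  have sa: "star a * p = star a" "p * star a = 0"
    using a1 by (metis projection_star[OF p] star_mult, metis projection_star[OF p] star_mult star.zero)
  have sa': "peirce (1 - p) p (\<nu> *\<^sub>C star a)"
    using sa by (simp add: peirce_compl_iff scaleC_simps)
  have ba: "b * star a * p = b * star a" "p * (b * star a) = b * star a"
    using sa b1 by (simp_all add: mult.assoc) (simp add: mult.assoc[symmetric])
  have ba': "peirce p p (\<nu> *\<^sub>C (b * star a))"
    using ba by (simp add: peirce_def scaleC_simps)
  have p11: "peirce p p p" and p22: "peirce (1 - p) (1 - p) (1 - p)"
    using pp by (simp_all add: peirce_def algebra_simps)
  have ab: "a * b = 0" using a1 b1 by (metis mult.assoc mult_zero_left)
  \<comment> \<open>The 12 component of this product is a + b, whereas biadditivity produces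
    \<open>\<Phi> a\<close> and \<open>\<Phi> b\<close> separately; the remaining terms agree and
    cancel.\<close>
  have "jordan_star_prod \<nu> (p + a) ((1 - p) + b)
      = \<nu> *\<^sub>C (b * star a) + (a + b) + \<nu> *\<^sub>C star a"
    using pp a1 b1 sa ab projection_star[OF p]
    by (simp add: jordan_star_prod_def star_simps scaleC_simps algebra_simps)
  hence lhs: "\<Phi> (jordan_star_prod \<nu> (p + a) ((1 - p) + b))
      = \<Phi> (\<nu> *\<^sub>C (b * star a)) + \<Phi> (a + b) + \<Phi> (\<nu> *\<^sub>C star a)"
    using peirce_sum[OF p ba' peirce_add[OF a b] sa' peirce_zero] by simp
  have \<Psi>: "\<Psi> (p + a) = \<Psi> p + \<Psi> a"
    using \<Psi>_eq[of "p + a" p a 0 0] peirce_sum[OF p p11 a peirce_zero peirce_zero]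
    by (simp add: \<Psi>_def)
  have \<Phi>: "\<Phi> ((1 - p) + b) = \<Phi> (1 - p) + \<Phi> b"
    using peirce_sum[OF p peirce_zero b peirce_zero p22] by (simp add: add.commute)
  have "\<Phi> (jordan_star_prod \<nu> (p + a) ((1 - p) + b))
      = \<Phi> (jordan_star_prod \<nu> p (1 - p)) + \<Phi> (jordan_star_prod \<nu> a (1 - p))
        + (\<Phi> (jordan_star_prod \<nu> p b) + \<Phi> (jordan_star_prod \<nu> a b))"
    unfolding prod \<Psi> \<Phi> by (simp add: jordan_star_prod_add_left jordan_star_prod_add_right)
  moreover have "jordan_star_prod \<nu> p (1 - p) = 0" "jordan_star_prod \<nu> p b = b"
    "jordan_star_prod \<nu> a (1 - p) = a + \<nu> *\<^sub>C star a" "jordan_star_prod \<nu> a b = \<nu> *\<^sub>C (b * star a)"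
    using pp a1 b1 sa ab projection_star[OF p]
    by (simp_all add: jordan_star_prod_def star_simps scaleC_simps algebra_simps)
  moreover have "\<Phi> (a + \<nu> *\<^sub>C star a) = \<Phi> a + \<Phi> (\<nu> *\<^sub>C star a)"
    using peirce_sum[OF p peirce_zero a sa' peirce_zero] by simp
  ultimately show ?thesis
    using lhs by (simp add: algebra_simps)
qed

lemma add_peirce11:
  assumes prime: "prime_algebra TYPE('a)" and np: "nontrivial_projection p"
    and a: "peirce p p a" and b: "peirce p p b"
  shows "\<Phi> (a + b) = \<Phi> a + \<Phi> b"
proof -
  have p: "projection p" and q: "1 - p \<noteq> 0"
    using np by (auto simp: nontrivial_projection_def)
  obtain h where h: "\<Phi> h = \<Phi> a + \<Phi> b" by (rule surjE)
  hence h4: "\<Phi> h = \<Phi> a + \<Phi> b + \<Phi> 0 + \<Phi> 0" by simp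
  \<comment> \<open>Multiplying by 1 - p gives the components of h the weights 0, \<nu>, 1, 1 +
    \<nu>, so the vanishing product confines h to the corner of p.\<close>
  have "jordan_star_prod \<nu> (1 - p) a = 0" "jordan_star_prod \<nu> (1 - p) b = 0"
    using a b projection_star[OF p]
    by (simp_all add: peirce_def jordan_star_prod_def star_simps algebra_simps)
  with prod_right[OF h4, of "1 - p"] have qh: "jordan_star_prod \<nu> (1 - p) h = 0"
    by (metis add_0 eq_iff jordan_star_prod_zero(2) zero)
  obtain h1 h2 h3 h4 where h': "peirce p p h1" "peirce p (1 - p) h2"
      "peirce (1 - p) p h3" "peirce (1 - p) (1 - p) h4" and sum: "h = h1 + h2 + h3 + h4"
    using peirce_decomposition[OF p] by metis
  have "0 + \<nu> *\<^sub>C h2 + h3 + (1 + \<nu>) *\<^sub>C h4 = 0 + 0 + 0 + 0"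
    using jordan_star_prod_peirce[OF p h', of \<nu> 0 1] qh sum by (simp add: scaleC_simps)
  from peirce_components_eq(2-4)[OF p _ _ _ _ _ _ _ _ this] h' have "h2 = 0" "h3 = 0" "h4 = 0"
    using \<nu>(1) weights_nonzero(1) by (simp_all add: peirce_scaleC)
  with h' sum have hh: "peirce p p h" by simp
  have off: "peirce (1 - p) p ((1 - p) * x * p * z)"
      "peirce p (1 - p) (\<nu> *\<^sub>C (z * star ((1 - p) * x * p)))"
      "jordan_star_prod \<nu> ((1 - p) * x * p) z
        = (1 - p) * x * p * z + \<nu> *\<^sub>C (z * star ((1 - p) * x * p))"
    if "peirce p p z" for x z
  proof -
    have z: "p * z = z" "z * p = z" "\<And>w. z * (p * w) = z * w" "\<And>w. p * (z * w) = z * w"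
      using that by (simp_all add: peirce_def flip: mult.assoc)
    note pp = projection_idem[OF p] projection_idem_left[OF p] projection_star[OF p]
    show "peirce (1 - p) p ((1 - p) * x * p * z)"
      by (simp add: peirce_compl_iff algebra_simps z pp)
    show "peirce p (1 - p) (\<nu> *\<^sub>C (z * star ((1 - p) * x * p)))"
      by (rule peirce_scaleC) (simp add: peirce_compl_iff algebra_simps z pp star_simps)
  qed (simp add: jordan_star_prod_def)
  have add21: "\<Phi> (u + v) = \<Phi> u + \<Phi> v" if "peirce (1 - p) p u" "peirce (1 - p) p v" for u v
    using add_peirce12[OF projection_compl[OF p]] that by simp
  have add_off: "\<Phi> (u + v) = \<Phi> u + \<Phi> v" if "peirce (1 - p) p u" "peirce p (1 - p) v" for u v
    using peirce_sum[OF p peirce_zero that(2,1) peirce_zero] by (simp add: add.commute)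
  have ab: "peirce p p (a + b)" by (rule peirce_add[OF a b])
  have "(1 - p) * x * (h - (a + b)) = 0" for x
  proof -
    \<comment> \<open>Products with y move the diagonal corner into the two off-diagonal ones, where
      additivity is already known.\<close>
    define y where "y = (1 - p) * x * p"
    note off' = off[of _ x, folded y_def]
    have "\<Phi> (jordan_star_prod \<nu> y (a + b)) = \<Phi> (y * (a + b)) + \<Phi> (\<nu> *\<^sub>C ((a + b) * star y))"
      using off'[OF ab] by (simp add: add_off)
    also have "\<dots> = \<Phi> (y * a) + \<Phi> (y * b) + \<Phi> (\<nu> *\<^sub>C (a * star y)) + \<Phi> (\<nu> *\<^sub>C (b * star y))"
      using add21[OF off'(1)[OF a] off'(1)[OF b]] add_peirce12[OF p off'(2)[OF a] off'(2)[OF b]]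
      by (simp add: distrib_left distrib_right scaleC_simps)
    also have "\<dots> = \<Phi> (jordan_star_prod \<nu> y a) + \<Phi> (jordan_star_prod \<nu> y b)"
      using off'[OF a] off'[OF b] by (simp add: add_off)
    also have "\<dots> = \<Phi> (jordan_star_prod \<nu> y h)"
      by (simp add: prod h jordan_star_prod_add_right)
    finally have "jordan_star_prod \<nu> y (a + b) = jordan_star_prod \<nu> y h"
      by (simp only: eq_iff)
    hence "0 + \<nu> *\<^sub>C ((a + b) * star y) + y * (a + b) + 0 = 0 + \<nu> *\<^sub>C (h * star y) + y * h + 0"
      using off'(3)[OF ab] off'(3)[OF hh] by (simp add: add.commute)
    from peirce_components_eq(3)[OF p _ _ _ _ _ _ _ _ this] off'[OF ab] off'[OF hh]
    have "y * (a + b) = y * h" by simp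
    \<comment> \<open>The p inside y is absorbed by h - (a + b), leaving an arbitrary x as primeness
      requires.\<close>
    thus ?thesis using hh ab by (simp add: y_def mult.assoc right_diff_distrib peirce_def)
  qed
  hence "h - (a + b) = 0"
    using prime q unfolding prime_algebra_def by blast
  thus ?thesis using h by simp
qed

lemma additive_on_prime:
  assumes prime: "prime_algebra TYPE('a)" and np: "nontrivial_projection (p :: 'a)"
  shows "additive \<Phi>"
proof
  fix a b
  have p: "projection p" using np by (simp add: nontrivial_projection_def)
  note q = projection_compl[OF p]
  obtain a1 a2 a3 a4 where a: "peirce p p a1" "peirce p (1 - p) a2"
      "peirce (1 - p) p a3" "peirce (1 - p) (1 - p) a4" and a_sum: "a = a1 + a2 + a3 + a4"
    using peirce_decomposition[OF p] by metis
  obtain b1 b2 b3 b4 where b: "peirce p p b1" "peirce p (1 - p) b2"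
      "peirce (1 - p) p b3" "peirce (1 - p) (1 - p) b4" and b_sum: "b = b1 + b2 + b3 + b4"
    using peirce_decomposition[OF p] by metis
  have "a + b = (a1 + b1) + (a2 + b2) + (a3 + b3) + (a4 + b4)"
    by (simp add: a_sum b_sum algebra_simps)
  hence "\<Phi> (a + b) = \<Phi> (a1 + b1) + \<Phi> (a2 + b2) + \<Phi> (a3 + b3) + \<Phi> (a4 + b4)"
    using peirce_sum[OF p] a b by (simp add: peirce_add)
  also have "\<dots> = \<Phi> a + \<Phi> b"
    using add_peirce11[OF prime np a(1) b(1)] add_peirce12[OF p a(2) b(2)]
      add_peirce12[OF q, of a3 b3] add_peirce11[OF prime nontrivial_projection_compl[OF np] a(4) b(4)]
      peirce_sum[OF p a] peirce_sum[OF p b] a b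
    by (simp add: a_sum b_sum algebra_simps)
  finally show "\<Phi> (a + b) = \<Phi> a + \<Phi> b" .
qed

section \<open>Multiplicativity\<close>

lemma map_one:
  assumes "projection (\<Phi> 1)"
  shows "\<Phi> 1 = 1"
proof -
  obtain b where b: "\<Phi> b = 1 - \<Phi> 1" by (rule surjE)
  have "jordan_star_prod \<eta> (\<Phi> 1) (\<Phi> b) = 0"
    using projection_idem[OF assms] projection_star[OF assms]
    by (simp add: b jordan_star_prod_def algebra_simps)
  with triple[of 1 b 1] have "jordan_star_prod \<nu> ((1 + \<eta>) *\<^sub>C b) 1 = 0"
    by (metis eq_iff zero jordan_star_prod_zero(1) jordan_star_prod_one_left)
  hence "(1 + \<eta>) *\<^sub>C b + \<nu> *\<^sub>C star ((1 + \<eta>) *\<^sub>C b) = 0"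
    by (simp add: jordan_star_prod_def)
  from scaleC_real_linear_eq_zero[OF \<nu>(2) this] have "b = 0" using one_plus_\<eta> by simp
  thus ?thesis using b by simp
qed

lemma star_ring_iso:
  assumes add: "additive \<Phi>" and proj: "projection (\<Phi> 1)"
    and scale: "\<And>a. \<Phi> ((\<nu> * (cnj \<eta> + 1)) *\<^sub>C a) = (\<nu> * (cnj \<eta> + 1)) *\<^sub>C \<Phi> a"
  shows "star_ring_iso \<Phi>"
proof -
  interpret additive \<Phi> by (rule add)
  note one = map_one[OF proj]
  define s where "s = 1 + \<eta>"
  define \<kappa> where "\<kappa> = \<nu> * (cnj \<eta> + 1)"
  have s: "s \<noteq> 0" using one_plus_\<eta> by (simp add: s_def)
  have cnj_s: "cnj s = cnj \<eta> + 1" by (simp add: s_def)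
  have \<kappa>: "\<kappa> \<noteq> 0" "\<kappa> = \<nu> * cnj s"
    using \<nu>(1) s by (simp_all add: \<kappa>_def flip: cnj_s)
  \<comment> \<open>The type is left generic so that the identity expands the triple product in both
    algebras.\<close>
  have expand: "jordan_star_prod \<nu> (jordan_star_prod \<eta> 1 b) c = s *\<^sub>C (b * c) + \<kappa> *\<^sub>C (c * star b)"
    for b c :: "'c::complex_star_algebra_1"
    by (simp add: jordan_star_prod_one_left jordan_star_prod_def star_simps scaleC_simps
        \<kappa>_def s_def algebra_simps)
  \<comment> \<open>Assumption (ii) extracts \<kappa>; homogeneity for s alone follows afterwards by
    setting b = 1.\<close>
  have main: "\<Phi> (s *\<^sub>C (b * c)) + \<kappa> *\<^sub>C \<Phi> (c * star b)
      = s *\<^sub>C (\<Phi> b * \<Phi> c) + \<kappa> *\<^sub>C (\<Phi> c * star (\<Phi> b))" for b c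
    using triple[of 1 b c] scale by (simp add: expand one add flip: \<kappa>_def)
  have \<Phi>_s: "\<Phi> (s *\<^sub>C c) = s *\<^sub>C \<Phi> c" for c
    using main[of 1 c] by (simp add: one)
  have \<Phi>_star: "\<Phi> (star c) = star (\<Phi> c)" for c
    using main[of c 1] \<kappa> by (simp add: one \<Phi>_s)
  define D where "D b c = \<Phi> (b * c) - \<Phi> b * \<Phi> c" for b c
  \<comment> \<open>This is -\<kappa> / s, of modulus |\<nu>| because \<open>cnj s / s\<close> has
    modulus 1.\<close>
  define t where "t = - (\<nu> * (cnj s / s))"
  have D: "D b c = t *\<^sub>C D c (star b)" for b c
  proof -
    have "s *\<^sub>C D b c + \<kappa> *\<^sub>C D c (star b) = 0"
      using main[of b c]
      by (simp add: D_def \<Phi>_s \<Phi>_star scaleC.scale_right_diff_distrib algebra_simps)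
    hence "s *\<^sub>C D b c = (- \<kappa>) *\<^sub>C D c (star b)"
      by (simp add: eq_neg_iff_add_eq_0)
    hence "inverse s *\<^sub>C (s *\<^sub>C D b c) = inverse s *\<^sub>C ((- \<kappa>) *\<^sub>C D c (star b))"
      by (rule arg_cong)
    thus ?thesis using s by (simp add: scaleC_simps t_def \<kappa>(2) divide_inverse mult_ac)
  qed
  have "D b c = 0" for b c
  proof -
    have "D b c = t *\<^sub>C D c (star b)"
      by (rule D)
    also have "\<dots> = t *\<^sub>C t *\<^sub>C D (star b) (star c)"
      by (simp only: D[of c])
    also have "\<dots> = t *\<^sub>C t *\<^sub>C t *\<^sub>C D (star c) (star (star b))"
      by (simp only: D[of "star b"])
    also have "\<dots> = t *\<^sub>C t *\<^sub>C t *\<^sub>C t *\<^sub>C D (star (star b)) (star (star c))"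
      by (simp only: D[of "star c"])
    finally have "D b c = (t * (t * (t * t))) *\<^sub>C D b c"
      by (simp add: star_star mult.assoc)
    hence "(1 - t * (t * (t * t))) *\<^sub>C D b c = 0"
      by (simp add: scaleC.scale_left_diff_distrib scaleC_one)
    moreover have "t * (t * (t * t)) \<noteq> 1"
    proof
      assume "t * (t * (t * t)) = 1"
      hence "t ^ 4 = 1" by (simp add: power4_eq_xxxx mult.assoc)
      hence "cmod t ^ 4 = 1" by (metis norm_power norm_one)
      moreover have "cmod t = cmod \<nu>"
        using s by (simp add: t_def norm_mult norm_divide)
      ultimately show False
        using \<nu>(2) power_eq_imp_eq_base[of "cmod \<nu>" 4 1] by simp
    qed
    ultimately show ?thesis by simp
  qed
  thus ?thesis
    using bij assms(1) \<Phi>_star by (simp add: star_ring_iso_def D_def)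
qed

end

section \<open>Rational homogeneity of additive maps\<close>

lemma additive_scaleC_Rats:
  fixes f :: "'a::complex_star_algebra_1 \<Rightarrow> 'b::complex_star_algebra_1"
  assumes "additive f" and "r \<in> \<rat>"
  shows "f (r *\<^sub>C a) = r *\<^sub>C f a"
proof -
  interpret additive f by fact
  have nat: "f (of_nat n *\<^sub>C x) = of_nat n *\<^sub>C f x" for n x
    by (induction n) (simp_all add: zero add scaleC_simps)
  have int: "f (of_int k *\<^sub>C x) = of_int k *\<^sub>C f x" for k x
    by (cases k rule: int_cases2) (simp_all add: nat minus)
  from \<open>r \<in> \<rat>\<close> obtain m n where n: "n > 0" and r: "r = of_int m / of_int n"
    by (metis Rats_cases')
  \<comment> \<open>Multiplying by the denominator reduces the claim to integer scalars; n is
    invertible and cancels.\<close>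
  have "of_int n *\<^sub>C f (r *\<^sub>C a) = f (of_int m *\<^sub>C a)"
    using n by (simp add: r scaleC_simps flip: int)
  also have "\<dots> = of_int n *\<^sub>C (r *\<^sub>C f a)"
    using n by (simp add: r scaleC_simps int)
  finally show ?thesis using n by (simp del: scaleC.scale_scale)
qed

theorem corollary2p1:
  fixes \<Phi> :: "'a::complex_star_algebra_1 \<Rightarrow> 'b::complex_star_algebra_1"
    and \<eta> \<nu> :: complex
  assumes "prime_algebra TYPE('a)"
    and "\<exists>p::'a. nontrivial_projection p"
    and "\<eta> \<noteq> 0" and "\<nu> \<noteq> 0" and "\<eta> \<noteq> -1" and "cmod \<nu> \<noteq> 1"
    and "bij \<Phi>"
    and "\<And>a b c. \<Phi> (jordan_star_prod \<nu> (jordan_star_prod \<eta> a b) c)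
      = jordan_star_prod \<nu> (jordan_star_prod \<eta> (\<Phi> a) (\<Phi> b)) (\<Phi> c)"
  shows "additive \<Phi> \<and>
    (projection (\<Phi> 1) \<and>
      (\<forall>a. \<Phi> ((\<nu> * (cnj \<eta> + 1)) *\<^sub>C a) = (\<nu> * (cnj \<eta> + 1)) *\<^sub>C \<Phi> a)
      \<longrightarrow> star_ring_iso \<Phi>) \<and>
    (projection (\<Phi> 1) \<and> \<nu> * (cnj \<eta> + 1) \<in> \<rat> \<longrightarrow> star_ring_iso \<Phi>)"
proof -
  interpret jordan_triple_map \<Phi> \<eta> \<nu>
    using assms(4-8) by unfold_locales
  have "additive \<Phi>" using assms(1,2) additive_on_prime by blast
  \<comment> \<open>In the rational case additivity itself supplies condition (ii).\<close>
  thus ?thesis using star_ring_iso additive_scaleC_Rats by blast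
qed

end
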